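(* (Reciprocity Theorem.) Let $\mathcal{A}$ be a finite arrangement of affine hyperplanes in $\mathbb{R}^n$, each defined by an equation $H:\ a_1x_1+\cdots+a_nx_n=b$ with $a_i,b\in\mathbb{Z}$, and let $\chi(\mathcal{A},t)$ be its characteristic polynomial. Let $q$ be a sufficiently large prime. Define \[\bar\chi(\mathcal{A},q)=\sum_{\Delta\in\mathscr{R}(\mathcal{A},q)}\big|\bar\Delta\cap C(n,q)\big|,\] where $\bar\Delta$ is the topological closure of $\Delta$. Then $\bar\chi(\mathcal{A},q)=(-1)^n\chi(\mathcal{A},-q)$; that is, $|\chi(\mathcal{A},-q)|$ is the total number of lattice points in $\bar\Delta\cap C(n,q)$ over all $\Delta\in\mathscr{R}(\mathcal{A},q)$.
   Context: $\chi(\mathcal{A},t)=\sum_{X\in L(\mathcal{A})}\mu(\mathbb{R}^n,X)t^{\dim X}$, where $L(\mathcal{A})$ is the set of nonempty intersections of subsets of $\mathcal{A}$ ordered by reverse inclusion and $\mu$ its Möbius function. $C(n,q)=\{(x_1,\dots,x_n)\in\mathbb{Z}^n: -\tfrac{q-1}{2}\le x_i\le\tfrac{q-1}{2}\ \forall i\}$. For $H:\ a_1x_1+\cdots+a_nx_n=b$ and $t\in\mathbb{R}$, $H(t)$ is the hyperplane $a_1x_1+\cdots+a_nx_n=b+t$. $M(\mathcal{A},q)=\mathbb{R}^n\setminus\bigcup_{H\in\mathcal{A},k\in\mathbb{Z}}H(kq)$, and $\mathscr{R}(\mathcal{A},q)$ is the set of connected components of $M(\mathcal{A},q)$. *)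

theory Defs
  imports "HOL-Analysis.Analysis" "HOL-Computational_Algebra.Computational_Algebra"
begin

definition hyperplane :: "int ^ 'n \<Rightarrow> real \<Rightarrow> (real ^ 'n) set" where
  "hyperplane a c = {x. (\<Sum>i\<in>UNIV. real_of_int (a $ i) * x $ i) = c}"

text \<open>
  The empty intersection \<^term>\<open>\<Inter>{} = UNIV\<close> is included, so the ambient space is the
  least element of the intersection poset with respect to reverse inclusion.
\<close>

definition intersection_poset :: "(real ^ 'n) set set \<Rightarrow> (real ^ 'n) set set" where
  "intersection_poset \<A> = {\<Inter>\<B> | \<B>. \<B> \<subseteq> \<A> \<and> \<Inter>\<B> \<noteq> {}}"

text \<open>
  The Moebius function of a finite family of sets \<open>L\<close> ordered by reverse inclusion:
  \<open>\<mu>(X,X) = 1\<close> and \<open>\<mu>(X,Y) = - (\<Sum>X \<le> Z < Y. \<mu>(X,Z))\<close> for \<open>X < Y\<close>, where \<open>X \<le> Z\<close>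
  means \<open>Z \<subseteq> X\<close>. It is meaningful only for a finite \<open>L\<close> that contains \<open>X\<close> and \<open>Y\<close>.
\<close>

function moebius :: "'a set set \<Rightarrow> 'a set \<Rightarrow> 'a set \<Rightarrow> int" where
  "moebius L X Y =
    (if infinite L \<or> \<not> Y \<subseteq> X then 0
     else if Y = X then 1
     else - (\<Sum>Z\<in>{Z \<in> L. Z \<subseteq> X \<and> Y \<subset> Z}. moebius L X Z))"
  by pat_completeness auto
termination
proof (relation "Wellfounded.measure (\<lambda>(L, X, Y). card {W \<in> L. Y \<subset> W})")
  fix L :: "'a set set" and X Y Z :: "'a set"
  assume "\<not> (infinite L \<or> \<not> Y \<subseteq> X)" and Z: "Z \<in> {Z \<in> L. Z \<subseteq> X \<and> Y \<subset> Z}"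
  then have "finite {W \<in> L. Y \<subset> W}" by simp
  moreover have "{W \<in> L. Z \<subset> W} \<subset> {W \<in> L. Y \<subset> W}" using Z by blast
  ultimately show "((L, X, Z), (L, X, Y)) \<in> Wellfounded.measure (\<lambda>(L, X, Y). card {W \<in> L. Y \<subset> W})"
    by (simp add: psubset_card_mono)
qed simp

declare moebius.simps [simp del]

definition characteristic_poly :: "(real ^ 'n) set set \<Rightarrow> int poly" where
  "characteristic_poly \<A> =
    (\<Sum>X\<in>intersection_poset \<A>.
       monom (moebius (intersection_poset \<A>) UNIV X) (nat (aff_dim X)))"

definition lattice_cube :: "nat \<Rightarrow> (real ^ 'n) set" where
  "lattice_cube q =
    {x. \<forall>i. x $ i \<in> \<int> \<and> - ((real q - 1) / 2) \<le> x $ i \<and> x $ i \<le> (real q - 1) / 2}"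

text \<open>
  The translates \<open>H(kq)\<close> depend on the chosen equation of \<open>H\<close> and not only on the set \<open>H\<close>;
  hence the equations, given by the functions \<open>a\<close> and \<open>b\<close> on \<open>\<A>\<close>, are parameters below.
\<close>

definition complement_mod ::
  "(real ^ 'n) set set \<Rightarrow> ((real ^ 'n) set \<Rightarrow> int ^ 'n) \<Rightarrow> ((real ^ 'n) set \<Rightarrow> int) \<Rightarrow> nat
    \<Rightarrow> (real ^ 'n) set" where
  "complement_mod \<A> a b q =
    UNIV - (\<Union>H\<in>\<A>. \<Union>k::int. hyperplane (a H) (real_of_int (b H) + real_of_int k * real q))"

definition regions_mod ::
  "(real ^ 'n) set set \<Rightarrow> ((real ^ 'n) set \<Rightarrow> int ^ 'n) \<Rightarrow> ((real ^ 'n) set \<Rightarrow> int) \<Rightarrow> nat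
    \<Rightarrow> (real ^ 'n) set set" where
  "regions_mod \<A> a b q = components (complement_mod \<A> a b q)"

text \<open>
  There are in general infinitely many regions, so the sum over them is an \<^const>\<open>infsum\<close>.
\<close>

definition chi_bar ::
  "(real ^ 'n) set set \<Rightarrow> ((real ^ 'n) set \<Rightarrow> int ^ 'n) \<Rightarrow> ((real ^ 'n) set \<Rightarrow> int) \<Rightarrow> nat
    \<Rightarrow> nat" where
  "chi_bar \<A> a b q = (\<Sum>\<^sub>\<infinity>\<Delta>\<in>regions_mod \<A> a b q. card (closure \<Delta> \<inter> lattice_cube q))"

end

theory Submission
  imports Defs "HOL-Number_Theory.Cong"
begin

text \<open>
  Summing over the lattice points \<open>p\<close> of the cube instead of the regions, one counts for each
  \<open>p\<close> the regions with \<open>p\<close> in their closure. These correspond to the regions of the central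
  arrangement formed by the \<open>H\<close> with \<open>a\<^sub>H \<bullet> p \<equiv> b\<^sub>H (mod q)\<close>, whose number is by deletion and
  restriction an alternating sum over its subsets \<open>B\<close>. Exchanging the sums leaves, for each
  \<open>B \<subseteq> \<A>\<close>, the number of solutions of a linear system modulo \<open>q\<close>; for a large prime \<open>q\<close> this is
  \<open>q\<close> to the power of the dimension of \<open>\<Inter>B\<close>, or \<open>0\<close> if \<open>\<Inter>B\<close> is empty. Whitney's formula for the
  characteristic polynomial as a sum over subsets then identifies the result.
\<close>

section \<open>Sign patterns of linear functionals\<close>

text \<open>A sign vector without zeros is encoded by the set \<open>S\<close> of the indices with
  positive sign.\<close>

definition cell :: "('i \<Rightarrow> 'a::euclidean_space) \<Rightarrow> 'i set \<Rightarrow> 'i set \<Rightarrow> 'a set" where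
  "cell v I S = {x. (\<forall>i\<in>S. 0 < v i \<bullet> x) \<and> (\<forall>i\<in>I - S. v i \<bullet> x < 0)}"

text \<open>The nonempty cells are the regions that the kernels of the \<open>v i\<close> cut out of
  \<open>V\<close>. An indexed family, unlike a set of vectors, may repeat a kernel or contain
  functionals that vanish on \<open>V\<close>; both arise under restriction.\<close>

definition sign_patterns :: "'a::euclidean_space set \<Rightarrow> ('i \<Rightarrow> 'a) \<Rightarrow> 'i set \<Rightarrow> 'i set set" where
  "sign_patterns V v I = {S. S \<subseteq> I \<and> V \<inter> cell v I S \<noteq> {}}"

lemma open_cell:
  assumes "finite I" "S \<subseteq> I"
  shows "open (cell v I S)"
proof -
  have "cell v I S = (\<Inter>i\<in>S. {x. 0 < v i \<bullet> x}) \<inter> (\<Inter>i\<in>I - S. {x. v i \<bullet> x < 0})"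
    unfolding cell_def by auto
  then show ?thesis
    using assms by (auto intro!: open_Int open_INT simp: open_halfspace_lt open_halfspace_gt finite_subset)
qed

lemma convex_cell: "convex (cell v I S)"
proof -
  have "cell v I S = (\<Inter>i\<in>S. {x. 0 < v i \<bullet> x}) \<inter> (\<Inter>i\<in>I - S. {x. v i \<bullet> x < 0})"
    unfolding cell_def by auto
  then show ?thesis
    by (auto intro!: convex_Int convex_INT simp: convex_halfspace_lt convex_halfspace_gt)
qed

lemma scaleR_in_cell: "x \<in> cell v I S \<Longrightarrow> 0 < t \<Longrightarrow> t *\<^sub>R x \<in> cell v I S"
  unfolding cell_def by (auto simp: mult_pos_neg)

lemma perturb_in_cell:
  assumes "finite I" "S \<subseteq> I" "x \<in> cell v I S"
  obtains e where "e > 0" "x + e *\<^sub>R w \<in> cell v I S" "x - e *\<^sub>R w \<in> cell v I S"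
proof -
  obtain r where r: "r > 0" "ball x r \<subseteq> cell v I S"
    using open_cell[OF assms(1,2)] assms(3) open_contains_ball by metis
  \<comment> \<open>The summand 1 keeps the denominator positive when \<open>w = 0\<close>.\<close>
  define e where "e = r / (norm w + 1)"
  have "norm w + 1 > 0" by (simp add: add_nonneg_pos)
  then have e: "e > 0" using r by (simp add: e_def)
  have "e * norm w < e * (norm w + 1)" using e by simp
  also have "\<dots> = r" using \<open>norm w + 1 > 0\<close> by (simp add: e_def)
  finally have "e * norm w < r" .
  then have "x + e *\<^sub>R w \<in> ball x r" "x - e *\<^sub>R w \<in> ball x r"
    using e by (auto simp: dist_norm)
  then show ?thesis using that e r by blast
qed

text \<open>A pattern on \<open>I\<close> extends to \<open>j\<close> with negative sign
  (\<open>X\<close>) or positive sign (\<open>Y\<close>). At least one extension always exists, and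
  both exist exactly if the cell meets the kernel of \<open>v j\<close>. The count is then
  inclusion-exclusion for \<open>X\<close> and \<open>Y\<close>.\<close>

lemma sign_patterns_deletion_restriction:
  assumes V: "subspace V" and I: "finite I" and j: "j \<notin> I" and w: "w \<in> V" "v j \<bullet> w \<noteq> 0"
  shows "card (sign_patterns V v (insert j I)) =
    card (sign_patterns V v I) + card (sign_patterns (V \<inter> {x. v j \<bullet> x = 0}) v I)"
proof -
  define P where "P = sign_patterns V v (insert j I)"
  define X where "X = {S. S \<subseteq> I \<and> S \<in> P}"
  define Y where "Y = {S. S \<subseteq> I \<and> insert j S \<in> P}"
  have fin: "finite X" "finite Y" using I by (auto simp: X_def Y_def)
  have Xiff: "S \<in> X \<longleftrightarrow> S \<subseteq> I \<and> (\<exists>x\<in>V. x \<in> cell v I S \<and> v j \<bullet> x < 0)" for S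
    using j unfolding X_def P_def sign_patterns_def cell_def by auto blast
  have Yiff: "S \<in> Y \<longleftrightarrow> S \<subseteq> I \<and> (\<exists>x\<in>V. x \<in> cell v I S \<and> 0 < v j \<bullet> x)" for S
  proof -
    have "insert j I - insert j S = I - S" if "S \<subseteq> I" using j by auto
    then show ?thesis
      unfolding Y_def P_def sign_patterns_def cell_def by auto
  qed
  obtain u where u: "u \<in> V" "v j \<bullet> u > 0"
  proof (cases "v j \<bullet> w > 0")
    case False
    then show thesis using w that[of "- w"] V by (simp add: subspace_neg)
  qed (use w that in blast)
  have P: "P = X \<union> insert j ` Y"
  proof (intro equalityI subsetI)
    fix S assume S: "S \<in> P"
    show "S \<in> X \<union> insert j ` Y"
    proof (cases "j \<in> S")
      case True
      then have "S = insert j (S - {j})" "S - {j} \<in> Y"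
        using S unfolding Y_def P_def sign_patterns_def by (auto simp: insert_absorb)
      then show ?thesis by blast
    next
      case False
      then show ?thesis using S unfolding X_def P_def sign_patterns_def by auto
    qed
  qed (auto simp: X_def Y_def)
  have "inj_on (insert j) Y"
  proof (rule inj_onI)
    fix S T assume "S \<in> Y" "T \<in> Y" "insert j S = insert j T"
    moreover have "j \<notin> S" "j \<notin> T" using calculation j by (auto simp: Y_def)
    ultimately show "S = T" by (metis Diff_insert_absorb)
  qed
  moreover have "X \<inter> insert j ` Y = {}" using j by (auto simp: X_def)
  ultimately have "card P = card X + card Y"
    unfolding P using fin by (simp add: card_Un_disjoint card_image)
  also have "\<dots> = card (X \<union> Y) + card (X \<inter> Y)"
    using fin by (rule card_Un_Int)
  also have "X \<union> Y = sign_patterns V v I"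
  proof (intro equalityI subsetI)
    fix S assume "S \<in> sign_patterns V v I"
    then obtain x where S: "S \<subseteq> I" and x: "x \<in> V" "x \<in> cell v I S"
      unfolding sign_patterns_def by blast
    show "S \<in> X \<union> Y"
    proof (cases "v j \<bullet> x = 0")
      \<comment> \<open>A witness on the kernel of \<open>v j\<close> is pushed off it along
        \<open>u\<close>; the cell is open, so a short push stays inside.\<close>
      case True
      obtain e where e: "e > 0" "x + e *\<^sub>R u \<in> cell v I S"
        using perturb_in_cell[OF I S x(2)] by metis
      then have "x + e *\<^sub>R u \<in> V" "0 < v j \<bullet> (x + e *\<^sub>R u)"
        using V x u True by (auto simp: subspace_add subspace_scale inner_add_right)
      then show ?thesis using e S Yiff by blast
    next
      case False
      then have "v j \<bullet> x < 0 \<or> 0 < v j \<bullet> x" by linarith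
      then show ?thesis using S x Xiff Yiff by blast
    qed
  qed (use Xiff Yiff in \<open>auto simp: sign_patterns_def\<close>)
  also have "X \<inter> Y = sign_patterns (V \<inter> {x. v j \<bullet> x = 0}) v I"
  proof (intro equalityI subsetI)
    fix S assume "S \<in> X \<inter> Y"
    then obtain x y where S: "S \<subseteq> I" and x: "x \<in> V" "x \<in> cell v I S" "v j \<bullet> x < 0"
      and y: "y \<in> V" "y \<in> cell v I S" "0 < v j \<bullet> y"
      using Xiff Yiff by auto
    \<comment> \<open>\<open>z\<close> is the point where the segment from \<open>x\<close> to
      \<open>y\<close> crosses the kernel of \<open>v j\<close>; convexity keeps it in the
      cell.\<close>
    define s where "s = v j \<bullet> y - v j \<bullet> x"
    define z where "z = (v j \<bullet> y / s) *\<^sub>R x + (- (v j \<bullet> x) / s) *\<^sub>R y"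
    have s: "s > 0" using x y by (simp add: s_def)
    have "v j \<bullet> y / s + - (v j \<bullet> x) / s = 1"
      using s by (simp flip: diff_divide_distrib add: s_def)
    then have "z \<in> cell v I S"
      unfolding z_def using x y s
      by (intro convexD[OF convex_cell]) (auto intro: divide_nonpos_pos)
    moreover have "z \<in> V"
      unfolding z_def using V x y by (intro subspace_add subspace_scale) auto
    moreover have "v j \<bullet> z = 0"
      unfolding z_def by (simp add: inner_add_right inner_diff_right)
    ultimately show "S \<in> sign_patterns (V \<inter> {x. v j \<bullet> x = 0}) v I"
      using S unfolding sign_patterns_def by auto
  next
    fix S assume "S \<in> sign_patterns (V \<inter> {x. v j \<bullet> x = 0}) v I"
    then obtain x where S: "S \<subseteq> I" and x: "x \<in> V" "x \<in> cell v I S" "v j \<bullet> x = 0"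
      unfolding sign_patterns_def by blast
    obtain e where e: "e > 0" "x + e *\<^sub>R u \<in> cell v I S" "x - e *\<^sub>R u \<in> cell v I S"
      using perturb_in_cell[OF I S x(2)] by metis
    have "x + e *\<^sub>R u \<in> V" "0 < v j \<bullet> (x + e *\<^sub>R u)" "x - e *\<^sub>R u \<in> V" "v j \<bullet> (x - e *\<^sub>R u) < 0"
      using V x u e
      by (auto simp: subspace_add subspace_diff subspace_scale inner_add_right inner_diff_right)
    then have "S \<in> X" "S \<in> Y"
      unfolding Xiff Yiff using e S by metis+
    then show "S \<in> X \<inter> Y" by simp
  qed
  finally show ?thesis unfolding P_def .
qed

lemma sign_patterns_insert_zero:
  assumes "\<And>x. x \<in> V \<Longrightarrow> v j \<bullet> x = 0"
  shows "sign_patterns V v (insert j I) = {}"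
proof -
  have False if "x \<in> V" "x \<in> cell v (insert j I) S" for x S
    using that assms[of x] by (cases "j \<in> S") (force simp: cell_def)+
  then show ?thesis by (auto simp: sign_patterns_def)
qed

section \<open>Counting sign patterns by dimensions of kernels\<close>

lemma dim_Int_kernel:
  fixes V :: "'a::euclidean_space set"
  assumes V: "subspace V" and w: "w \<in> V" "u \<bullet> w \<noteq> 0"
  shows "dim V = Suc (dim (V \<inter> {x. u \<bullet> x = 0}))"
proof -
  let ?K = "V \<inter> {x. u \<bullet> x = 0}"
  have K: "subspace ?K"
    using V by (intro subspace_inter subspace_hyperplane)
  then have spK: "span ?K = ?K" by (simp add: span_eq_iff)
  have "V = span (insert w ?K)"
  proof (intro equalityI subsetI)
    fix x assume x: "x \<in> V"
    let ?k = "(u \<bullet> x) / (u \<bullet> w)"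
    have "x - ?k *\<^sub>R w \<in> ?K"
      using x V w by (simp add: subspace_diff subspace_scale inner_diff_right)
    then show "x \<in> span (insert w ?K)"
      unfolding span_insert spK by blast
  next
    fix x assume "x \<in> span (insert w ?K)"
    then show "x \<in> V"
      using span_minimal[of "insert w ?K" V] V w by auto
  qed
  then have "dim V = dim (insert w ?K)" by (metis dim_span)
  also have "\<dots> = Suc (dim ?K)"
  proof -
    have "w \<notin> span ?K" using w unfolding spK by simp
    then show ?thesis by (simp add: dim_insert)
  qed
  finally show ?thesis .
qed

lemma sum_Pow_insert:
  assumes "finite I" "j \<notin> I"
  shows "(\<Sum>B\<in>Pow (insert j I). f B) = (\<Sum>B\<in>Pow I. f B) + (\<Sum>B\<in>Pow I. f (insert j B))"
proof -
  have "inj_on (insert j) (Pow I)"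
    using assms by (intro inj_onI) (metis Diff_insert_absorb PowD subsetD)
  moreover have "Pow I \<inter> insert j ` Pow I = {}" using assms by auto
  ultimately show ?thesis
    using assms by (simp add: Pow_insert sum.union_disjoint sum.reindex)
qed

text \<open>Zaslavsky's region count in Whitney form. Only the parity of the exponent matters, so
  dimensions are added instead of subtracted. The induction generalizes over \<open>V\<close>
  because restriction replaces \<open>V\<close> by a hyperplane of it.\<close>

lemma card_sign_patterns:
  assumes "finite I" "subspace V"
  shows "int (card (sign_patterns V v I)) =
    (\<Sum>B\<in>Pow I. (-1) ^ (card B + dim V + dim (V \<inter> {x. \<forall>i\<in>B. v i \<bullet> x = 0})))"
  using assms
proof (induction I arbitrary: V rule: finite_induct)
  case empty
  have "V \<inter> cell v {} {} \<noteq> {}"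
    using empty subspace_0 by (auto simp: cell_def)
  then have "sign_patterns V v {} = {{}}"
    by (auto simp: sign_patterns_def)
  then show ?case by (simp flip: mult_2)
next
  case (insert j I)
  let ?K = "V \<inter> {x. v j \<bullet> x = 0}"
  let ?f = "\<lambda>V B. (-1::int) ^ (card B + dim V + dim (V \<inter> {x. \<forall>i\<in>B. v i \<bullet> x = 0}))"
  have split: "sum (?f V) (Pow (insert j I)) =
      sum (?f V) (Pow I) + (\<Sum>B\<in>Pow I. ?f V (insert j B))"
    using insert.hyps by (rule sum_Pow_insert)
  have B: "card (insert j B) = Suc (card B)"
    "V \<inter> {x. \<forall>i\<in>insert j B. v i \<bullet> x = 0} = ?K \<inter> {x. \<forall>i\<in>B. v i \<bullet> x = 0}" if "B \<in> Pow I" for B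
  proof -
    have "finite B" "j \<notin> B" using that insert.hyps finite_subset by auto
    then show "card (insert j B) = Suc (card B)" by simp
  qed auto
  show ?case
  proof (cases "\<exists>w\<in>V. v j \<bullet> w \<noteq> 0")
    case True
    then obtain w where w: "w \<in> V" "v j \<bullet> w \<noteq> 0" by blast
    have K: "subspace ?K"
      using insert.prems by (intro subspace_inter subspace_hyperplane)
    \<comment> \<open>Passing from \<open>V\<close> to \<open>?K\<close> lowers the dimension by one
      and removing \<open>j\<close> lowers the cardinality by one, so the parity is
      unchanged.\<close>
    have "?f V (insert j B) = ?f ?K B" if "B \<in> Pow I" for B
      unfolding B[OF that] dim_Int_kernel[OF insert.prems w] by simp
    then have "(\<Sum>B\<in>Pow I. ?f V (insert j B)) = sum (?f ?K) (Pow I)"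
      by (intro sum.cong) auto
    then show ?thesis
      unfolding split sign_patterns_deletion_restriction[where V=V and v=v, OF insert.prems insert.hyps w]
      using insert.IH[OF insert.prems] insert.IH[OF K] by simp
  next
    case False
    \<comment> \<open>If \<open>v j\<close> vanishes on \<open>V\<close>, inserting \<open>j\<close>
      changes only the sign. The sum cancels, in agreement with the absence of sign
      patterns.\<close>
    then have "?K = V" by auto
    then have "?f V (insert j B) = - ?f V B" if "B \<in> Pow I" for B
      unfolding B[OF that] by simp
    then have "(\<Sum>B\<in>Pow I. ?f V (insert j B)) = - sum (?f V) (Pow I)"
      by (simp add: sum_negf)
    then show ?thesis
      unfolding split using False by (simp add: sign_patterns_insert_zero)
  qed
qed

section \<open>Regions at a point\<close>

text \<open>No \<open>v i \<bullet> (x - p)\<close> vanishes on \<open>M\<close>, so each has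
  constant sign on a component. Within \<open>ball p e\<close> the set \<open>M\<close> is exactly
  the complement of the hyperplanes through \<open>p\<close>, so every cell, moved to
  \<open>p\<close> and cut down to the ball, lies in a single component.\<close>

lemma bij_betw_components_sign_patterns:
  fixes p :: "'a::euclidean_space"
  assumes e: "e > 0"
    and M: "\<And>x i. x \<in> M \<Longrightarrow> i \<in> I \<Longrightarrow> v i \<bullet> (x - p) \<noteq> 0"
    and near: "\<And>x. x \<in> ball p e \<Longrightarrow> (\<And>i. i \<in> I \<Longrightarrow> v i \<bullet> (x - p) \<noteq> 0) \<Longrightarrow> x \<in> M"
  shows "bij_betw (\<lambda>D. {i \<in> I. \<forall>x\<in>D. 0 < v i \<bullet> (x - p)})
    {D \<in> components M. p \<in> closure D} (sign_patterns UNIV v I)"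
proof -
  define f where "f D = {i \<in> I. \<forall>x\<in>D. 0 < v i \<bullet> (x - p)}" for D
  have fI: "f D \<subseteq> I" for D by (auto simp: f_def)
  have sub: "x - p \<in> cell v I (f D)" if D: "D \<in> components M" and x: "x \<in> D" for D x
  proof -
    have "v i \<bullet> (x - p) < 0" if i: "i \<in> I" "i \<notin> f D" for i
    proof (rule ccontr)
      \<comment> \<open>A functional that changes sign on the connected set \<open>D\<close> would
        vanish somewhere on it, by the intermediate value theorem.\<close>
      assume "\<not> v i \<bullet> (x - p) < 0"
      moreover obtain y where y: "y \<in> D" "v i \<bullet> (y - p) \<le> 0"
        using i by (force simp: f_def)
      moreover have "connected D" using D by (rule in_components_connected)
      ultimately obtain z where "z \<in> D" "v i \<bullet> z = v i \<bullet> p"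
        using connected_ivt_hyperplane[of D y x "v i" "v i \<bullet> p"] x
        by (auto simp: inner_diff_right)
      moreover have "D \<subseteq> M" using D by (rule in_components_subset)
      ultimately show False
        using M[of z i] i by (auto simp: inner_diff_right)
    qed
    then show ?thesis using x by (auto simp: cell_def f_def)
  qed
  define piece where "piece S = (\<lambda>x. p + x) ` (cell v I S \<inter> ball 0 e)" for S
  have conn: "connected (piece S)" for S
    unfolding piece_def
    by (intro convex_connected convex_translation convex_Int convex_cell convex_ball)
  have pieceM: "piece S \<subseteq> M" if "S \<subseteq> I" for S
  proof
    fix x assume "x \<in> piece S"
    then obtain y where y: "x = p + y" "y \<in> cell v I S" "norm y < e"
      by (auto simp: piece_def)
    have "v i \<bullet> y \<noteq> 0" if "i \<in> I" for i
      using y(2) that by (cases "i \<in> S") (force simp: cell_def)+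
    then show "x \<in> M" using y by (intro near) (auto simp: dist_norm)
  qed
  have "inj_on f {D \<in> components M. p \<in> closure D}"
  proof (rule inj_onI)
    fix D E assume D: "D \<in> {D \<in> components M. p \<in> closure D}"
      and E: "E \<in> {D \<in> components M. p \<in> closure D}" and eq: "f D = f E"
    \<comment> \<open>A component with \<open>p\<close> in its closure has a point in the ball, and
      this point lies in the piece of its own pattern. Hence the component contains that whole
      piece, and two components with the same pattern overlap.\<close>
    have meets: "piece (f D) \<inter> D \<noteq> {}" if D: "D \<in> components M" "p \<in> closure D" for D
    proof -
      obtain x where x: "x \<in> D" "dist x p < e"
        using D(2) e closure_approachable by blast
      then have "x \<in> piece (f D)"
        unfolding piece_def using sub[OF D(1) x(1)]
        by (intro image_eqI[of _ _ "x - p"]) (auto simp: dist_norm norm_minus_commute)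
      then show ?thesis using x by blast
    qed
    have "piece (f D) \<subseteq> D" "piece (f D) \<subseteq> E"
      using meets[of D] meets[of E] D E eq conn pieceM[OF fI] components_maximal
      by (metis (no_types, lifting) inf_commute mem_Collect_eq)+
    then show "D = E"
      using meets[of D] D E components_nonoverlap[of D M E] by blast
  qed
  moreover have "f ` {D \<in> components M. p \<in> closure D} = sign_patterns UNIV v I"
  proof (intro equalityI subsetI)
    fix S assume "S \<in> f ` {D \<in> components M. p \<in> closure D}"
    then obtain D where D: "D \<in> components M" "S = f D" by blast
    then obtain x where "x \<in> D" using in_components_nonempty by blast
    then show "S \<in> sign_patterns UNIV v I"
      using sub[OF D(1)] D fI by (auto simp: sign_patterns_def)
  next
    fix S assume "S \<in> sign_patterns UNIV v I"
    then obtain x where S: "S \<subseteq> I" and x: "x \<in> cell v I S"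
      by (auto simp: sign_patterns_def)
    \<comment> \<open>Cells are cones, so the ray from \<open>p\<close> in direction
      \<open>x\<close> starts inside the piece. This puts \<open>p\<close> into the closure of the
      component constructed below.\<close>
    have seg: "p + t *\<^sub>R x \<in> piece S" if "0 < t" "t * norm x < e" for t
      unfolding piece_def using scaleR_in_cell[OF x that(1)] that by auto
    have small: "\<exists>t>0. t * norm x < r" if "r > 0" for r
    proof (intro exI conjI)
      have pos: "norm x + 1 > 0" by (simp add: add_nonneg_pos)
      then show "r / (norm x + 1) > 0" using that by simp
      show "r / (norm x + 1) * norm x < r" using that pos by (simp add: field_simps)
    qed
    obtain t0 where t0: "t0 > 0" "t0 * norm x < e" using small[OF e] by blast
    define D where "D = connected_component_set M (p + t0 *\<^sub>R x)"
    have in_M: "p + t0 *\<^sub>R x \<in> M" using seg[OF t0] pieceM[OF S] by blast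
    then have D: "D \<in> components M" unfolding D_def by (rule componentsI)
    have pD: "piece S \<subseteq> D"
      unfolding D_def using seg[OF t0] conn pieceM[OF S] by (intro connected_component_maximal)
    have "p \<in> closure D"
      unfolding closure_approachable
    proof (intro allI impI)
      fix r :: real assume "r > 0"
      then obtain t where t: "t > 0" "t * norm x < min r e" using small[of "min r e"] e by auto
      then have "p + t *\<^sub>R x \<in> D" using seg pD by auto
      moreover have "dist (p + t *\<^sub>R x) p < r" using t by (simp add: dist_norm)
      ultimately show "\<exists>y\<in>D. dist y p < r" by blast
    qed
    moreover have "f D = S"
    proof -
      have "t0 *\<^sub>R x \<in> cell v I (f D)"
        using sub[OF D, of "p + t0 *\<^sub>R x"] pD seg[OF t0] by auto
      then have "(0 < v i \<bullet> x \<longleftrightarrow> i \<in> f D)" if "i \<in> I" for i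
        using that t0 by (cases "i \<in> f D") (force simp: cell_def zero_less_mult_iff mult_less_0_iff)+
      moreover have "(0 < v i \<bullet> x \<longleftrightarrow> i \<in> S)" if "i \<in> I" for i
        using that x by (cases "i \<in> S") (force simp: cell_def)+
      ultimately show ?thesis using S fI by blast
    qed
    ultimately show "S \<in> f ` {D \<in> components M. p \<in> closure D}"
      using D by blast
  qed
  ultimately show ?thesis unfolding bij_betw_def f_def by blast
qed

section \<open>Integer linear systems modulo a large prime\<close>

text \<open>Congruences are treated over integer vectors and geometry over real ones;
  \<open>rvec\<close> links the two.\<close>

definition rvec :: "int ^ 'n \<Rightarrow> real ^ 'n" where
  "rvec z = (\<chi> i. real_of_int (z $ i))"

definition idot :: "int ^ 'n \<Rightarrow> int ^ 'n \<Rightarrow> int" where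
  "idot u z = (\<Sum>i\<in>UNIV. u $ i * z $ i)"

lemma hyperplane_eq: "hyperplane u c = {x. rvec u \<bullet> x = c}"
  by (simp add: hyperplane_def rvec_def inner_vec_def)

lemma rvec_inner_rvec: "rvec u \<bullet> rvec z = real_of_int (idot u z)"
  by (simp add: rvec_def idot_def inner_vec_def)

lemma inj_rvec: "inj rvec"
  by (auto simp: inj_on_def rvec_def vec_eq_iff)

lemma idot_add: "idot u (x + y) = idot u x + idot u y"
  by (simp add: idot_def sum.distrib ring_distribs)

lemma idot_diff: "idot u (x - y) = idot u x - idot u y"
  by (simp add: idot_def sum_subtractf ring_distribs)

lemma idot_scale: "idot u (k *s x) = k * idot u x"
  by (simp add: idot_def sum_distrib_left mult_ac)

lemma idot_commute: "idot u x = idot x u"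
  by (simp add: idot_def mult.commute)

lemma idot_sum: "idot u (sum f B) = (\<Sum>i\<in>B. idot u (f i))"
  by (simp add: idot_def sum_distrib_left sum.swap[of _ B])

lemma idot_self_eq_0: "idot u u = 0 \<longleftrightarrow> u = 0"
  by (simp add: idot_def sum_nonneg_eq_0_iff vec_eq_iff)

lemma rvec_scale: "rvec (k *s x) = real_of_int k *\<^sub>R rvec x"
  by (simp add: rvec_def vec_eq_iff)

lemma rvec_sum: "rvec (sum f B) = (\<Sum>i\<in>B. rvec (f i))"
  by (simp add: rvec_def vec_eq_iff)

text \<open>Gaussian elimination without fractions. All witnesses are integral and independent of
  \<open>q\<close>, so the nonzero integers \<open>d\<close> and \<open>idot u w\<close> remain
  nonzero modulo every large prime.\<close>

lemma integer_dependence_or_separation: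
  assumes "finite B"
  shows "(\<exists>d c. d \<noteq> 0 \<and> d *s u = (\<Sum>i\<in>B. c i *s a i)) \<or>
    (\<exists>w. (\<forall>i\<in>B. idot (a i) w = 0) \<and> idot u w \<noteq> 0)"
  using assms
proof (induction B arbitrary: u rule: finite_induct)
  case empty
  show ?case
  proof (cases "u = 0")
    case True
    then show ?thesis by (auto intro!: exI[of _ 1])
  next
    case False
    then show ?thesis using idot_self_eq_0 by auto
  qed
next
  case (insert e B)
  have extend: "(\<Sum>i\<in>insert e B. (c(e := k)) i *s a i) = k *s a e + (\<Sum>i\<in>B. c i *s a i)" for c k
  proof -
    have "(\<Sum>i\<in>B. (c(e := k)) i *s a i) = (\<Sum>i\<in>B. c i *s a i)"
      using insert.hyps by (intro sum.cong) auto
    then show ?thesis using insert.hyps by simp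
  qed
  consider (dep) d c where "d \<noteq> 0" "d *s u = (\<Sum>i\<in>B. c i *s a i)"
    | (sep) w where "\<forall>i\<in>B. idot (a i) w = 0" "idot u w \<noteq> 0"
    using insert.IH[of u] by blast
  then show ?case
  proof cases
    case dep
    then have "d *s u = (\<Sum>i\<in>insert e B. (c(e := 0)) i *s a i)"
      unfolding extend by simp
    then show ?thesis using dep(1) by blast
  next
    case sep
    let ?k = "idot (a e) w"
    show ?thesis
    proof (cases "?k = 0")
      case True
      then show ?thesis using sep by auto
    next
      case False
      \<comment> \<open>\<open>?u\<close> is a combination of \<open>u\<close> and
        \<open>a e\<close> that is orthogonal to \<open>w\<close>; the induction hypothesis is
        applied to it in place of \<open>u\<close>.\<close>
      let ?u = "?k *s u - idot u w *s a e"
      consider (dep') d c where "d \<noteq> 0" "d *s ?u = (\<Sum>i\<in>B. c i *s a i)"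
        | (sep') w' where "\<forall>i\<in>B. idot (a i) w' = 0" "idot ?u w' \<noteq> 0"
        using insert.IH[of ?u] by blast
      then show ?thesis
      proof cases
        case dep'
        have "(d * ?k) *s u = (d * idot u w) *s a e + d *s ?u"
          by (simp add: vec_eq_iff algebra_simps)
        also have "\<dots> = (\<Sum>i\<in>insert e B. (c(e := d * idot u w)) i *s a i)"
          unfolding extend dep'(2) by simp
        finally show ?thesis using dep'(1) False by (metis mult_eq_0_iff)
      next
        case sep'
        \<comment> \<open>The multiple of \<open>w\<close> makes \<open>?w\<close> orthogonal to
          \<open>a e\<close> without affecting its orthogonality to the vectors of
          \<open>B\<close>.\<close>
        let ?w = "?k *s w' - idot (a e) w' *s w"
        have "idot u ?w = idot ?u w'"
          by (simp add: idot_commute[of _ w'] idot_diff idot_scale)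
        moreover have "\<forall>i\<in>insert e B. idot (a i) ?w = 0"
          using sep sep' by (simp add: idot_diff idot_scale)
        ultimately show ?thesis using sep'(2) by metis
      qed
    qed
  qed
qed

section \<open>Residue classes modulo q and solutions of congruences\<close>

definition residue_box :: "nat \<Rightarrow> int \<Rightarrow> (int ^ 'n) set" where
  "residue_box q h = {z. \<forall>i. z $ i \<in> {- h..<int q - h}}"

text \<open>For positive \<open>q\<close> the box holds one representative of every class modulo
  \<open>q\<close>, so the cardinality is the number of solutions over the integers modulo
  \<open>q\<close>. The offset \<open>h\<close> is left free so that the box can later be the
  centered cube.\<close>

definition solutions_mod ::
  "nat \<Rightarrow> int \<Rightarrow> ('i \<Rightarrow> int ^ 'n) \<Rightarrow> ('i \<Rightarrow> int) \<Rightarrow> 'i set \<Rightarrow> (int ^ 'n) set" where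
  "solutions_mod q h a b B = {z \<in> residue_box q h. \<forall>i\<in>B. int q dvd idot (a i) z - b i}"

lemma residue_box_bij: "bij_betw vec_nth (residue_box q h :: (int ^ 'n) set) (UNIV \<rightarrow>\<^sub>E {- h..<int q - h})"
proof (rule bij_betwI[where g = vec_lambda])
qed (auto simp: residue_box_def PiE_UNIV_domain)

lemma card_residue_box: "card (residue_box q h :: (int ^ 'n) set) = q ^ CARD('n)"
  using bij_betw_same_card[OF residue_box_bij[of q h]] by (simp add: card_PiE)

lemma finite_residue_box: "finite (residue_box q h :: (int ^ 'n) set)"
  using bij_betw_finite[OF residue_box_bij[of q h]] by (simp add: finite_PiE)

lemma residue_box_unique:
  fixes z z' :: "int ^ 'n"
  assumes "z \<in> residue_box q h" "z' \<in> residue_box q h" "\<And>i. int q dvd z $ i - z' $ i"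
  shows "z = z'"
proof (rule vec_eq_iff[THEN iffD2], rule allI)
  fix i
  have "z $ i \<in> {- h..<int q - h}" "z' $ i \<in> {- h..<int q - h}"
    using assms(1,2) by (simp_all add: residue_box_def)
  then have "\<bar>z $ i - z' $ i\<bar> < int q" by auto
  then have "z $ i - z' $ i = 0" using assms(3)[of i] dvd_imp_le_int[of "z $ i - z' $ i" "int q"] by force
  then show "z $ i = z' $ i" by simp
qed

definition reduce :: "nat \<Rightarrow> int \<Rightarrow> int ^ 'n \<Rightarrow> int ^ 'n" where
  "reduce q h z = (\<chi> i. (z $ i + h) mod int q - h)"

lemma reduce_in_box: "q > 0 \<Longrightarrow> reduce q h z \<in> residue_box q h"
  by (auto simp: reduce_def residue_box_def)

lemma dvd_reduce:
  fixes z :: "int ^ 'n"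
  shows "int q dvd reduce q h z $ i - z $ i"
proof -
  have "reduce q h z $ i - z $ i = - (int q * ((z $ i + h) div int q))"
    using div_mult_mod_eq[of "z $ i + h" "int q"] by (simp add: reduce_def algebra_simps)
  then show ?thesis by simp
qed

lemma dvd_idot:
  fixes x y :: "int ^ 'n"
  assumes "\<And>i. k dvd x $ i - y $ i"
  shows "k dvd idot u x - idot u y"
proof -
  have "k dvd (\<Sum>i\<in>UNIV. u $ i * (x - y) $ i)"
    using assms by (intro dvd_sum dvd_mult) simp
  then show ?thesis by (simp flip: idot_diff add: idot_def[of u "x - y"])
qed

lemma dvd_idot_reduce: "int q dvd idot u (reduce q h z) - c \<longleftrightarrow> int q dvd idot u z - c"
proof -
  have "int q dvd idot u (reduce q h z) - idot u z" by (intro dvd_idot dvd_reduce)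
  then have "int q dvd (idot u (reduce q h z) - idot u z) + (idot u z - c) \<longleftrightarrow> int q dvd idot u z - c"
    by (rule dvd_add_right_iff)
  then show ?thesis by simp
qed

text \<open>This is translation by \<open>y\<close> on residue classes, read off on representatives;
  translation by \<open>- y\<close> inverts it.\<close>

lemma bij_betw_reduce_translate:
  assumes "q > 0"
  shows "bij_betw (\<lambda>z. reduce q h (z + y)) (residue_box q h) (residue_box q h)"
proof -
  have inv: "reduce q h (reduce q h (z + y) + x) = z"
    if "z \<in> residue_box q h" "y + x = 0" for x y z :: "int ^ 'n"
  proof (rule residue_box_unique[OF reduce_in_box[OF assms] that(1)])
    fix i
    have "int q dvd (reduce q h (reduce q h (z + y) + x) $ i - (reduce q h (z + y) + x) $ i)
        + (reduce q h (z + y) $ i - (z + y) $ i)"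
      by (intro dvd_add dvd_reduce)
    moreover have x: "x = - y" using that(2) by (simp add: eq_neg_iff_add_eq_0 add.commute)
    ultimately show "int q dvd reduce q h (reduce q h (z + y) + x) $ i - z $ i"
      by simp
  qed
  show ?thesis
    by (rule bij_betwI[where g = "\<lambda>z. reduce q h (z + - y)"])
       (use inv[of _ y "- y"] inv[of _ "- y" y] reduce_in_box[OF assms] in auto)
qed

text \<open>
  Counts the pairs \<open>(z, k)\<close> such that \<open>z + k w\<close> satisfies the new congruence: every solution \<open>z\<close>
  of the old system admits exactly one \<open>k\<close>, and translation by \<open>k w\<close> permutes these solutions.
\<close>

lemma card_solutions_mod_insert:
  fixes a :: "'i \<Rightarrow> int ^ 'n"
  assumes q: "prime q" and w: "\<forall>i\<in>B. idot (a i) w = 0" and d: "\<not> int q dvd idot (a j) w"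
  shows "card (solutions_mod q h a b B) = q * card (solutions_mod q h a b (insert j B))"
proof -
  let ?S = "solutions_mod q h a b B" and ?T = "solutions_mod q h a b (insert j B)"
  have q0: "q > 0" using q by (simp add: prime_gt_0_nat)
  have fin: "finite ?S" "finite ?T"
    by (auto simp: solutions_mod_def finite_residue_box)
  have one: "card {k \<in> {0..<int q}. int q dvd idot (a j) (z + k *s w) - b j} = 1" for z
  proof -
    have cop: "coprime (idot (a j) w) (int q)"
      using q d by (simp add: coprime_commute prime_imp_coprime)
    then obtain y where y: "[idot (a j) w * y = 1] (mod int q)"
      using cong_solve_coprime_int by blast
    \<comment> \<open>In \<open>k\<close> the new congruence is linear with leading coefficient
      \<open>idot (a j) w\<close>, a unit modulo \<open>q\<close> with inverse \<open>y\<close>;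
      \<open>k0\<close> is its only root.\<close>
    define k0 where "k0 = (y * (b j - idot (a j) z)) mod int q"
    have k0: "k0 \<in> {0..<int q}" using q0 by (simp add: k0_def)
    have "[idot (a j) w * k0 = idot (a j) w * (y * (b j - idot (a j) z))] (mod int q)"
      by (intro cong_mult cong_refl) (simp add: k0_def cong_def)
    also have "idot (a j) w * (y * (b j - idot (a j) z)) = (idot (a j) w * y) * (b j - idot (a j) z)"
      by simp
    also have "[\<dots> = 1 * (b j - idot (a j) z)] (mod int q)"
      using y by (intro cong_mult cong_refl)
    finally have k0': "[idot (a j) w * k0 = b j - idot (a j) z] (mod int q)" by simp
    have iff: "int q dvd idot (a j) (z + k *s w) - b j \<longleftrightarrow>
        [idot (a j) w * k = b j - idot (a j) z] (mod int q)" for k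
      by (simp add: cong_iff_dvd_diff idot_add idot_scale algebra_simps)
    have "k = k0" if "k \<in> {0..<int q}" "int q dvd idot (a j) (z + k *s w) - b j" for k
    proof -
      have "[idot (a j) w * k = idot (a j) w * k0] (mod int q)"
        using that(2) k0' unfolding iff by (metis cong_sym cong_trans)
      then have "[k = k0] (mod int q)" using cop by (simp add: cong_mult_lcancel)
      then show ?thesis using that(1) k0 by (simp add: cong_def)
    qed
    then have "{k \<in> {0..<int q}. int q dvd idot (a j) (z + k *s w) - b j} = {k0}"
      using k0 k0' iff by blast
    then show ?thesis by simp
  qed
  have trans: "card {z \<in> ?S. int q dvd idot (a j) (z + k *s w) - b j} = card ?T" for k
  proof (rule bij_betw_same_card[where f = "\<lambda>z. reduce q h (z + k *s w)"], rule bij_betw_subset)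
    show "bij_betw (\<lambda>z. reduce q h (z + k *s w)) (residue_box q h) (residue_box q h)"
      by (rule bij_betw_reduce_translate[OF q0])
    show "{z \<in> ?S. int q dvd idot (a j) (z + k *s w) - b j} \<subseteq> residue_box q h"
      by (auto simp: solutions_mod_def)
    have mem: "reduce q h (z + k *s w) \<in> ?T \<longleftrightarrow>
        z \<in> ?S \<and> int q dvd idot (a j) (z + k *s w) - b j" if "z \<in> residue_box q h" for z
      using that reduce_in_box[OF q0, of h "z + k *s w"] w
      by (auto simp: solutions_mod_def dvd_idot_reduce) (auto simp: idot_add idot_scale)
    show "(\<lambda>z. reduce q h (z + k *s w)) ` {z \<in> ?S. int q dvd idot (a j) (z + k *s w) - b j} = ?T"
    proof (intro equalityI subsetI)
      fix y assume y: "y \<in> ?T"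
      then have "y \<in> residue_box q h" by (simp add: solutions_mod_def)
      then obtain z where "z \<in> residue_box q h" "y = reduce q h (z + k *s w)"
        using bij_betw_imp_surj_on[OF bij_betw_reduce_translate[OF q0, of h "k *s w"]] by blast
      then show "y \<in> (\<lambda>z. reduce q h (z + k *s w)) ` {z \<in> ?S. int q dvd idot (a j) (z + k *s w) - b j}"
        using y mem by blast
    qed (use mem in \<open>auto simp: solutions_mod_def\<close>)
  qed
  have "card ?S = (\<Sum>z\<in>?S. card {k \<in> {0..<int q}. int q dvd idot (a j) (z + k *s w) - b j})"
    unfolding one by simp
  also have "\<dots> = (\<Sum>k\<in>{0..<int q}. card {z \<in> ?S. int q dvd idot (a j) (z + k *s w) - b j})"
    using fin by (intro sum_multicount_gen) auto
  also have "\<dots> = q * card ?T" unfolding trans by simp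
  finally show ?thesis .
qed

section \<open>Solution counts for large primes\<close>

lemma eventually_not_dvd:
  fixes m :: int
  assumes "m \<noteq> 0"
  shows "\<forall>\<^sub>F q in sequentially. \<not> int q dvd m"
proof (rule eventually_sequentiallyI)
  fix q assume "nat \<bar>m\<bar> + 1 \<le> q"
  then show "\<not> int q dvd m" using assms dvd_imp_le_int[of m "int q"] by force
qed

lemma subspace_orthogonal_family: "subspace {x. \<forall>i\<in>B. (v i :: 'a::real_inner) \<bullet> x = 0}"
  by (auto simp: subspace_def inner_add_right)

text \<open>Equations are added one at a time. If the new normal is independent of the old ones, the
  solution count is divided by \<open>q\<close> and the dimension drops by one. If it is dependent,
  the new equation is either implied or contradictory, in the same way over the reals and modulo
  \<open>q\<close>. The integers that \<open>q\<close> must not divide do not depend on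
  \<open>h\<close>, so one threshold serves all boxes.\<close>

lemma eventually_card_solutions_mod:
  fixes a :: "'i \<Rightarrow> int ^ 'n"
  assumes "finite B"
  shows "\<forall>\<^sub>F q in sequentially. prime q \<longrightarrow> (\<forall>h. card (solutions_mod q h a b B) =
    (if (\<Inter>i\<in>B. hyperplane (a i) (real_of_int (b i))) = {} then 0
     else q ^ dim {x. \<forall>i\<in>B. rvec (a i) \<bullet> x = 0}))"
  using assms
proof (induction B rule: finite_induct)
  case empty
  have "solutions_mod q h a b {} = residue_box q h" for q h by (simp add: solutions_mod_def)
  then show ?case by (simp add: card_residue_box)
next
  case (insert j B)
  let ?F = "\<lambda>B. \<Inter>i\<in>B. hyperplane (a i) (real_of_int (b i))"
  let ?W = "\<lambda>B. {x. \<forall>i\<in>B. rvec (a i) \<bullet> x = 0}"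
  have sub: "solutions_mod q h a b (insert j B) \<subseteq> solutions_mod q h a b B" for q h
    by (auto simp: solutions_mod_def)
  have fin: "finite (solutions_mod q h a b B)" for q h
    by (auto simp: solutions_mod_def finite_residue_box)
  show ?case
  proof (cases "?F B = {}")
    case True
    then have "?F (insert j B) = {}" by auto
    moreover have "card (solutions_mod q h a b (insert j B)) = 0"
      if "card (solutions_mod q h a b B) = 0" for q h
      using that sub[of q h] fin[of q h] by auto
    ultimately show ?thesis
      using insert.IH True by (auto elim!: eventually_mono)
  next
    case False
    then obtain x where x: "\<And>i. i \<in> B \<Longrightarrow> rvec (a i) \<bullet> x = real_of_int (b i)"
      by (auto simp: hyperplane_eq)
    consider (dep) d c where "d \<noteq> 0" "d *s a j = (\<Sum>i\<in>B. c i *s a i)"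
      | (sep) w where "\<forall>i\<in>B. idot (a i) w = 0" "idot (a j) w \<noteq> 0"
      using integer_dependence_or_separation[OF insert.hyps(1), of "a j" a] by blast
    then show ?thesis
    proof cases
      case dep
      have real: "real_of_int d * (rvec (a j) \<bullet> y) = (\<Sum>i\<in>B. real_of_int (c i) * (rvec (a i) \<bullet> y))" for y
        using arg_cong[OF dep(2), of "\<lambda>u. rvec u \<bullet> y"]
        by (simp add: rvec_scale rvec_sum inner_sum_left)
      have int: "d * idot (a j) z = (\<Sum>i\<in>B. c i * idot (a i) z)" for z
        using arg_cong[OF dep(2), of "\<lambda>u. idot z u"]
        by (simp add: idot_scale idot_sum) (simp add: idot_commute)
      have W: "?W (insert j B) = ?W B"
      proof -
        have "rvec (a j) \<bullet> y = 0" if "y \<in> ?W B" for y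
          using real[of y] that dep(1) by simp
        then show ?thesis by auto
      qed
      \<comment> \<open>\<open>m\<close> is \<open>d\<close> times the error of equation
        \<open>j\<close> on solutions of the old system: exactly over the reals
        (\<open>on_F\<close>), up to multiples of \<open>q\<close> in the box
        (\<open>on_S\<close>).\<close>
      define m where "m = (\<Sum>i\<in>B. c i * b i) - d * b j"
      have on_F: "real_of_int d * (rvec (a j) \<bullet> y - b j) = real_of_int m" if "y \<in> ?F B" for y
      proof -
        have "(\<Sum>i\<in>B. real_of_int (c i) * (rvec (a i) \<bullet> y)) = (\<Sum>i\<in>B. real_of_int (c i) * b i)"
          using that by (intro sum.cong) (auto simp: hyperplane_eq)
        then show ?thesis using real[of y] by (simp add: m_def algebra_simps)
      qed
      have on_S: "int q dvd d * (idot (a j) z - b j) - m" if "z \<in> solutions_mod q h a b B" for q h z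
      proof -
        have "d * (idot (a j) z - b j) - m = (\<Sum>i\<in>B. c i * (idot (a i) z - b i))"
          using int[of z] by (simp add: m_def algebra_simps sum_subtractf)
        moreover have "int q dvd \<dots>"
          using that by (intro dvd_sum dvd_mult) (auto simp: solutions_mod_def)
        ultimately show ?thesis by simp
      qed
      show ?thesis
      proof (cases "m = 0")
        case True
        have F: "?F (insert j B) = ?F B"
          using on_F True dep(1) by (auto simp: hyperplane_eq)
        have "\<forall>\<^sub>F q in sequentially. prime q \<longrightarrow>
            (\<forall>h. solutions_mod q h a b (insert j B) = solutions_mod q h a b B)"
        proof (use eventually_not_dvd[OF dep(1)] in eventually_elim, intro impI allI)
          fix q h assume q: "\<not> int q dvd d" "prime q"
          have "int q dvd idot (a j) z - b j" if "z \<in> solutions_mod q h a b B" for z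
            using on_S[OF that] True q by (auto simp: prime_dvd_mult_iff)
          then show "solutions_mod q h a b (insert j B) = solutions_mod q h a b B"
            by (auto simp: solutions_mod_def)
        qed
        then show ?thesis
          using insert.IH unfolding F W by eventually_elim simp
      next
        case m: False
        have "?F (insert j B) = {}"
          using on_F m by (force simp: hyperplane_eq)
        moreover have "\<forall>\<^sub>F q in sequentially. \<forall>h. solutions_mod q h a b (insert j B) = {}"
        proof (use eventually_not_dvd[OF m] in eventually_elim, intro allI)
          fix q h assume q: "\<not> int q dvd m"
          have False if z: "z \<in> solutions_mod q h a b (insert j B)" for z
          proof -
            have "int q dvd d * (idot (a j) z - b j)"
              using z by (auto simp: solutions_mod_def)
            moreover have "int q dvd d * (idot (a j) z - b j) - m"
              using on_S z sub by blast
            ultimately have "int q dvd d * (idot (a j) z - b j) - (d * (idot (a j) z - b j) - m)"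
              by (rule dvd_diff)
            then show False using q by simp
          qed
          then show "solutions_mod q h a b (insert j B) = {}" by blast
        qed
        ultimately show ?thesis by (auto elim!: eventually_mono)
      qed
    next
      case sep
      have w: "rvec w \<in> ?W B" "rvec (a j) \<bullet> rvec w \<noteq> 0"
        using sep by (auto simp: rvec_inner_rvec)
      have "?W B \<inter> {x. rvec (a j) \<bullet> x = 0} = ?W (insert j B)" by auto
      then have dim: "dim (?W B) = Suc (dim (?W (insert j B)))"
        using dim_Int_kernel[OF subspace_orthogonal_family w] by simp
      \<comment> \<open>The old solution \<open>x\<close> is moved along \<open>w\<close> until
        equation \<open>j\<close> holds; the old equations are not disturbed.\<close>
      let ?y = "x + ((b j - rvec (a j) \<bullet> x) / (rvec (a j) \<bullet> rvec w)) *\<^sub>R rvec w"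
      have "?y \<in> ?F (insert j B)"
        using x w by (auto simp: hyperplane_eq inner_add_right)
      then have F: "?F (insert j B) \<noteq> {}" by blast
      have "\<forall>\<^sub>F q in sequentially. \<not> int q dvd idot (a j) w"
        by (rule eventually_not_dvd[OF sep(2)])
      then show ?thesis
        using insert.IH
      proof eventually_elim
        case (elim q)
        show ?case
        proof (intro impI allI)
          fix h assume q: "prime q"
          have "q * card (solutions_mod q h a b (insert j B)) = q * q ^ dim (?W (insert j B))"
            using card_solutions_mod_insert[OF q sep(1) elim(1), of h b] elim(2) q False
            unfolding dim by simp
          then have "card (solutions_mod q h a b (insert j B)) = q ^ dim (?W (insert j B))"
            using prime_gt_0_nat[OF q] by simp
          then show "card (solutions_mod q h a b (insert j B)) =
              (if ?F (insert j B) = {} then 0 else q ^ dim (?W (insert j B)))"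
            using F by simp
        qed
      qed
    qed
  qed
qed

section \<open>Whitney's formula for the characteristic polynomial\<close>

lemma sum_minus_one_power_card_Pow:
  assumes "finite A"
  shows "(\<Sum>B\<in>Pow A. (-1::int) ^ card B) = (if A = {} then 1 else 0)"
  using assms
proof (induction A rule: finite_induct)
  case (insert x A)
  have "(\<Sum>B\<in>Pow A. (-1::int) ^ card (insert x B)) = (\<Sum>B\<in>Pow A. - ((-1) ^ card B))"
  proof (rule sum.cong)
    fix B assume "B \<in> Pow A"
    then have "finite B" "x \<notin> B" using insert.hyps finite_subset by auto
    then show "(-1::int) ^ card (insert x B) = - ((-1) ^ card B)" by simp
  qed simp
  then show ?case
    unfolding sum_Pow_insert[OF insert.hyps] by (simp add: sum_negf)
qed simp

text \<open>The signed sums \<open>f\<close> obey the recursion that determines the Moebius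
  function: summing \<open>f\<close> over all \<open>Z\<close> containing \<open>Y\<close> gives the
  alternating sum over the subsets of the hyperplanes containing \<open>Y\<close>, which vanishes
  unless there are none, that is, unless \<open>Y = UNIV\<close>.\<close>

lemma moebius_eq_signed_sum:
  assumes A: "finite \<A>" "UNIV \<notin> \<A>" and X: "X \<in> intersection_poset \<A>"
  shows "moebius (intersection_poset \<A>) UNIV X = (\<Sum>B | B \<subseteq> \<A> \<and> \<Inter>B = X. (-1) ^ card B)"
proof -
  define L where "L = intersection_poset \<A>"
  have "L \<subseteq> Inter ` Pow \<A>" by (auto simp: L_def intersection_poset_def)
  then have finL: "finite L" using A(1) finite_subset by blast
  define f where "f Y = (\<Sum>B | B \<subseteq> \<A> \<and> \<Inter>B = Y. (-1::int) ^ card B)" for Y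
  have finB: "finite {B. B \<subseteq> \<A> \<and> P B}" for P using A(1) by simp
  have up: "(\<Sum>Z | Z \<in> L \<and> Y \<subseteq> Z. f Z) = (if Y = UNIV then 1 else 0)" if Y: "Y \<in> L" for Y
  proof -
    have ne: "Y \<noteq> {}" using Y by (auto simp: L_def intersection_poset_def)
    have "(\<Sum>Z | Z \<in> L \<and> Y \<subseteq> Z. f Z) = (\<Sum>B\<in>(\<Union>Z\<in>{Z \<in> L. Y \<subseteq> Z}. {B. B \<subseteq> \<A> \<and> \<Inter>B = Z}). (-1) ^ card B)"
      unfolding f_def using finL finB by (intro sum.UNION_disjoint[symmetric]) auto
    also have "(\<Union>Z\<in>{Z \<in> L. Y \<subseteq> Z}. {B. B \<subseteq> \<A> \<and> \<Inter>B = Z}) = Pow {H \<in> \<A>. Y \<subseteq> H}"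
    proof -
      \<comment> \<open>Since \<open>Y\<close> is nonempty, so is every intersection containing it;
        no subset of these hyperplanes is lost by passing to \<open>L\<close>.\<close>
      have "\<Inter>B \<in> L" if "B \<subseteq> \<A>" "Y \<subseteq> \<Inter>B" for B
        using that ne by (auto simp: L_def intersection_poset_def)
      then show ?thesis by (auto simp: le_Inf_iff)
    qed
    also have "(\<Sum>B\<in>\<dots>. (-1::int) ^ card B) = (if {H \<in> \<A>. Y \<subseteq> H} = {} then 1 else 0)"
      using A(1) by (intro sum_minus_one_power_card_Pow) simp
    also have "{H \<in> \<A>. Y \<subseteq> H} = {} \<longleftrightarrow> Y = UNIV"
    proof
      assume none: "{H \<in> \<A>. Y \<subseteq> H} = {}"
      obtain B where "B \<subseteq> \<A>" "Y = \<Inter>B" using Y by (auto simp: L_def intersection_poset_def)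
      then show "Y = UNIV" using none by blast
    qed (use A(2) in \<open>auto simp: top.extremum_unique\<close>)
    finally show ?thesis .
  qed
  have "moebius L UNIV Y = f Y" if "Y \<in> L" for Y
    using that
  proof (induction "card {Z \<in> L. Y \<subset> Z}" arbitrary: Y rule: less_induct)
    case less
    have rec: "f Y = (if Y = UNIV then 1 else 0) - (\<Sum>Z\<in>{Z \<in> L. Y \<subset> Z}. f Z)"
    proof -
      have "{Z \<in> L. Y \<subseteq> Z} = insert Y {Z \<in> L. Y \<subset> Z}" using less.prems by auto
      then have "(\<Sum>Z | Z \<in> L \<and> Y \<subseteq> Z. f Z) = f Y + (\<Sum>Z\<in>{Z \<in> L. Y \<subset> Z}. f Z)"
        using finL by simp
      then show ?thesis using up[OF less.prems] by simp
    qed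
    have IH: "(\<Sum>Z\<in>{Z \<in> L. Y \<subset> Z}. moebius L UNIV Z) = (\<Sum>Z\<in>{Z \<in> L. Y \<subset> Z}. f Z)"
    proof (rule sum.cong)
      fix Z assume Z: "Z \<in> {Z \<in> L. Y \<subset> Z}"
      then have "{W \<in> L. Z \<subset> W} \<subset> {W \<in> L. Y \<subset> W}" by blast
      then have "card {W \<in> L. Z \<subset> W} < card {W \<in> L. Y \<subset> W}"
        using finL by (simp add: psubset_card_mono)
      then show "moebius L UNIV Z = f Z" using less.hyps Z by blast
    qed simp
    show ?case
    proof (cases "Y = UNIV")
      case True
      then have "{Z \<in> L. Y \<subset> Z} = {}" by auto
      then show ?thesis using True finL rec by (subst moebius.simps) auto
    next
      case False
      then show ?thesis using finL rec IH by (subst moebius.simps) auto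
    qed
  qed
  then show ?thesis using X by (simp add: f_def L_def)
qed

text \<open>The subsets \<open>B\<close> are grouped by their intersection, which turns each Moebius
  value into its signed sum.\<close>

lemma poly_characteristic_poly:
  assumes A: "finite \<A>" "UNIV \<notin> \<A>"
  shows "poly (characteristic_poly \<A>) t =
    (\<Sum>B | B \<subseteq> \<A> \<and> \<Inter>B \<noteq> {}. (-1) ^ card B * t ^ nat (aff_dim (\<Inter>B)))"
proof -
  let ?L = "intersection_poset \<A>"
  have "?L \<subseteq> Inter ` Pow \<A>" by (auto simp: intersection_poset_def)
  then have finL: "finite ?L" using A(1) finite_subset by blast
  have "poly (characteristic_poly \<A>) t =
      (\<Sum>X\<in>?L. moebius ?L UNIV X * t ^ nat (aff_dim X))"
    by (simp add: characteristic_poly_def poly_sum poly_monom)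
  also have "\<dots> = (\<Sum>X\<in>?L. \<Sum>B | B \<subseteq> \<A> \<and> \<Inter>B = X. (-1) ^ card B * t ^ nat (aff_dim (\<Inter>B)))"
    by (intro sum.cong) (auto simp: moebius_eq_signed_sum[OF A] sum_distrib_right)
  also have "\<dots> = (\<Sum>B\<in>(\<Union>X\<in>?L. {B. B \<subseteq> \<A> \<and> \<Inter>B = X}). (-1) ^ card B * t ^ nat (aff_dim (\<Inter>B)))"
    using finL A(1) by (intro sum.UNION_disjoint[symmetric]) auto
  also have "(\<Union>X\<in>?L. {B. B \<subseteq> \<A> \<and> \<Inter>B = X}) = {B. B \<subseteq> \<A> \<and> \<Inter>B \<noteq> {}}"
    by (auto simp: intersection_poset_def)
  finally show ?thesis .
qed

section \<open>Reciprocity\<close>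

text \<open>A nonempty intersection is a translate of the solution space of the homogeneous
  system.\<close>

lemma aff_dim_Inter_hyperplane:
  assumes "(\<Inter>i\<in>B. hyperplane (a i) (b i)) \<noteq> {}"
  shows "aff_dim (\<Inter>i\<in>B. hyperplane (a i) (b i)) = int (dim {x. \<forall>i\<in>B. rvec (a i) \<bullet> x = 0})"
proof -
  let ?W = "{x. \<forall>i\<in>B. rvec (a i) \<bullet> x = 0}"
  obtain p where p: "p \<in> (\<Inter>i\<in>B. hyperplane (a i) (b i))" using assms by blast
  have "x \<in> (\<Inter>i\<in>B. hyperplane (a i) (b i)) \<longleftrightarrow> x - p \<in> ?W" for x
    using p by (auto simp: hyperplane_eq inner_diff_right)
  then have "(\<Inter>i\<in>B. hyperplane (a i) (b i)) = (\<lambda>x. p + x) ` ?W"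
    by (auto simp: image_iff) (metis add_diff_cancel_left' diff_add_cancel add.commute)+
  then show ?thesis
    by (simp add: aff_dim_translation_eq aff_dim_subspace[OF subspace_orthogonal_family])
qed

text \<open>The translates through the lattice point are those of the hyperplanes in
  \<open>I\<close>. All others stay away from it uniformly, although there are infinitely many: at
  an integer point both sides of their equations are integers, so they differ by at least 1.\<close>

lemma card_regions_at_lattice_point:
  fixes z :: "int ^ 'n" and a :: "(real ^ 'n) set \<Rightarrow> int ^ 'n"
    and b :: "(real ^ 'n) set \<Rightarrow> int" and q :: nat
  assumes "finite \<A>"
  defines "I \<equiv> {H \<in> \<A>. int q dvd idot (a H) z - b H}"
  shows "finite {D \<in> regions_mod \<A> a b q. rvec z \<in> closure D}"
    and "card {D \<in> regions_mod \<A> a b q. rvec z \<in> closure D} =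
      card (sign_patterns UNIV (\<lambda>H. rvec (a H)) I)"
proof -
  let ?M = "complement_mod \<A> a b q"
  have M: "x \<in> ?M \<longleftrightarrow>
      (\<forall>H\<in>\<A>. \<forall>k::int. rvec (a H) \<bullet> x \<noteq> real_of_int (b H) + real_of_int k * real q)" for x
    by (auto simp: complement_mod_def hyperplane_eq)
  \<comment> \<open>\<open>s\<close> bounds the norms of all normals, so within distance
    \<open>e\<close> of the lattice point no left-hand side changes by as much as 1.\<close>
  define s where "s = (\<Sum>H\<in>\<A>. norm (rvec (a H)))"
  define e where "e = 1 / (s + 1)"
  have s: "s \<ge> 0" by (simp add: s_def sum_nonneg)
  then have e: "e > 0" by (simp add: e_def)
  have bij: "bij_betw (\<lambda>D. {i \<in> I. \<forall>x\<in>D. 0 < rvec (a i) \<bullet> (x - rvec z)})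
    {D \<in> components ?M. rvec z \<in> closure D} (sign_patterns UNIV (\<lambda>H. rvec (a H)) I)"
  proof (rule bij_betw_components_sign_patterns[OF e])
    fix x H assume x: "x \<in> ?M" and H: "H \<in> I"
    obtain k where "idot (a H) z - b H = int q * k" using H by (auto simp: I_def)
    then have "idot (a H) z = b H + k * int q" by (simp add: algebra_simps)
    then have "rvec (a H) \<bullet> rvec z = real_of_int (b H) + real_of_int k * real q"
      unfolding rvec_inner_rvec by simp
    then show "rvec (a H) \<bullet> (x - rvec z) \<noteq> 0"
      using x H unfolding M by (auto simp: inner_diff_right I_def)
  next
    fix x assume x: "x \<in> ball (rvec z) e" and nz: "\<And>H. H \<in> I \<Longrightarrow> rvec (a H) \<bullet> (x - rvec z) \<noteq> 0"
    show "x \<in> ?M"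
      unfolding M
    proof (intro ballI allI notI)
      fix H and k :: int
      assume H: "H \<in> \<A>" and eq: "rvec (a H) \<bullet> x = real_of_int (b H) + real_of_int k * real q"
      have "norm (rvec (a H)) \<le> s"
        unfolding s_def using H assms(1) by (intro member_le_sum) auto
      then have "\<bar>rvec (a H) \<bullet> (x - rvec z)\<bar> \<le> s * norm (x - rvec z)"
        by (intro order_trans[OF Cauchy_Schwarz_ineq2] mult_right_mono) auto
      also have "\<dots> \<le> s * e"
        using x s by (intro mult_left_mono) (auto simp: dist_norm norm_minus_commute)
      also have "s * e < 1" using s by (simp add: e_def)
      finally have "\<bar>real_of_int (b H + k * int q - idot (a H) z)\<bar> < 1"
        by (simp add: inner_diff_right eq rvec_inner_rvec)
      then have "b H + k * int q - idot (a H) z = 0" by linarith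
      then have 1: "idot (a H) z = b H + k * int q" by simp
      then have "H \<in> I" using H by (simp add: I_def)
      moreover have "rvec (a H) \<bullet> (x - rvec z) = 0"
        by (simp add: inner_diff_right eq rvec_inner_rvec 1)
      ultimately show False using nz by blast
    qed
  qed
  have "sign_patterns UNIV (\<lambda>H. rvec (a H)) I \<subseteq> Pow I" by (auto simp: sign_patterns_def)
  moreover have "finite I" using assms(1) by (simp add: I_def)
  ultimately have "finite (sign_patterns UNIV (\<lambda>H. rvec (a H)) I)"
    using finite_subset by blast
  then show "finite {D \<in> regions_mod \<A> a b q. rvec z \<in> closure D}"
    using bij_betw_finite[OF bij] by (simp add: regions_mod_def)
  show "card {D \<in> regions_mod \<A> a b q. rvec z \<in> closure D} =
      card (sign_patterns UNIV (\<lambda>H. rvec (a H)) I)"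
    using bij_betw_same_card[OF bij] by (simp add: regions_mod_def)
qed

text \<open>For \<open>q = 2 * h + 1\<close> the half-open range from \<open>- h\<close> to
  \<open>q - h\<close> consists of the integers from \<open>- h\<close> to \<open>h\<close>.\<close>

lemma lattice_cube_eq_residue_box:
  assumes "odd q"
  shows "(lattice_cube q :: (real ^ 'n) set) = rvec ` residue_box q (int (q div 2))"
proof -
  define h where "h = q div 2"
  have q: "q = 2 * h + 1" using assms by (auto simp: h_def elim: oddE)
  have half: "(real q - 1) / 2 = real h" by (simp add: q)
  have box: "z \<in> residue_box q (int h) \<longleftrightarrow> (\<forall>i. - int h \<le> z $ i \<and> z $ i \<le> int h)" for z :: "int ^ 'n"
    by (auto simp: residue_box_def q; smt (verit))
  have cast: "- real h \<le> real_of_int k \<longleftrightarrow> - int h \<le> k" "real_of_int k \<le> real h \<longleftrightarrow> k \<le> int h" for k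
    by linarith+
  show ?thesis
    unfolding h_def[symmetric]
  proof (intro equalityI subsetI)
    fix x :: "real ^ 'n" assume x: "x \<in> lattice_cube q"
    define z :: "int ^ 'n" where "z = (\<chi> i. \<lfloor>x $ i\<rfloor>)"
    have "x = rvec z"
      using x by (auto simp: lattice_cube_def rvec_def z_def vec_eq_iff)
    moreover have "z \<in> residue_box q (int h)"
      using x unfolding calculation box lattice_cube_def half by (auto simp: rvec_def cast)
    ultimately show "x \<in> rvec ` residue_box q (int h)" by blast
  next
    fix x :: "real ^ 'n" assume "x \<in> rvec ` residue_box q (int h)"
    then show "x \<in> lattice_cube q"
      by (auto simp: box lattice_cube_def half rvec_def cast)
  qed
qed

text \<open>Pairs of a region and a lattice point of its closure are counted in two ways.
  Summability is recorded because \<open>infsum\<close> would otherwise have the default value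
  0.\<close>

lemma chi_bar_eq_sum_sign_patterns:
  fixes \<A> :: "(real ^ 'n) set set" and a :: "(real ^ 'n) set \<Rightarrow> int ^ 'n"
  assumes A: "finite \<A>" and q: "odd q"
  shows "(\<lambda>D. card (closure D \<inter> lattice_cube q)) summable_on regions_mod \<A> a b q"
    and "chi_bar \<A> a b q = (\<Sum>z\<in>residue_box q (int (q div 2)).
      card (sign_patterns UNIV (\<lambda>H. rvec (a H)) {H \<in> \<A>. int q dvd idot (a H) z - b H}))"
proof -
  let ?R = "regions_mod \<A> a b q" and ?Z = "residue_box q (int (q div 2)) :: (int ^ 'n) set"
  let ?f = "\<lambda>D. card (closure D \<inter> lattice_cube q)"
  \<comment> \<open>Only finitely many regions have a point of the cube in their closure; all other
    terms are zero, so the infinite sum reduces to \<open>G\<close>.\<close>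
  define G where "G = (\<Union>z\<in>?Z. {D \<in> ?R. rvec z \<in> closure D})"
  have G: "finite G" "G \<subseteq> ?R"
    unfolding G_def using card_regions_at_lattice_point(1)[OF A]
    by (auto simp: finite_residue_box)
  have f: "?f D = card {z \<in> ?Z. rvec z \<in> closure D}" for D
  proof -
    have "closure D \<inter> lattice_cube q = rvec ` {z \<in> ?Z. rvec z \<in> closure D}"
      unfolding lattice_cube_eq_residue_box[OF q] by blast
    then show ?thesis
      by (simp add: card_image inj_on_subset[OF inj_rvec])
  qed
  have zero: "?f D = 0" if "D \<in> ?R - G" for D
  proof -
    have "{z \<in> ?Z. rvec z \<in> closure D} = {}" using that by (auto simp: G_def)
    then show ?thesis unfolding f by (simp only: card.empty)
  qed
  have "?f summable_on ?R \<longleftrightarrow> ?f summable_on G"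
    using zero G by (intro summable_on_cong_neutral) auto
  then show "?f summable_on ?R" using G by simp
  have "chi_bar \<A> a b q = infsum ?f G"
    unfolding chi_bar_def using zero G by (intro infsum_cong_neutral) auto
  also have "\<dots> = (\<Sum>D\<in>G. card {z \<in> ?Z. rvec z \<in> closure D})"
    using G by (simp add: f)
  also have "\<dots> = (\<Sum>z\<in>?Z. card {D \<in> G. rvec z \<in> closure D})"
    using G finite_residue_box by (intro sum_multicount_gen) auto
  also have "\<dots> = (\<Sum>z\<in>?Z. card (sign_patterns UNIV (\<lambda>H. rvec (a H)) {H \<in> \<A>. int q dvd idot (a H) z - b H}))"
  proof (rule sum.cong)
    fix z assume "z \<in> ?Z"
    then have "{D \<in> G. rvec z \<in> closure D} = {D \<in> ?R. rvec z \<in> closure D}"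
      by (auto simp: G_def)
    then show "card {D \<in> G. rvec z \<in> closure D} =
        card (sign_patterns UNIV (\<lambda>H. rvec (a H)) {H \<in> \<A>. int q dvd idot (a H) z - b H})"
      using card_regions_at_lattice_point(2)[OF A] by simp
  qed simp
  finally show "chi_bar \<A> a b q = \<dots>" .
qed

text \<open>\<open>card_sign_patterns\<close> is applied at each lattice point. After the exchange
  of sums, the points \<open>z\<close> at which a given \<open>B\<close> contributes are the
  solutions of the system of \<open>B\<close> modulo \<open>q\<close>.\<close>

lemma chi_bar_eq_sum_solutions_mod:
  fixes \<A> :: "(real ^ 'n) set set" and a :: "(real ^ 'n) set \<Rightarrow> int ^ 'n"
  assumes A: "finite \<A>" and q: "odd q"
  shows "int (chi_bar \<A> a b q) = (\<Sum>B\<in>Pow \<A>.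
    (-1) ^ (card B + CARD('n) + dim {x. \<forall>H\<in>B. rvec (a H) \<bullet> x = 0}) *
    int (card (solutions_mod q (int (q div 2)) a b B)))"
proof -
  let ?Z = "residue_box q (int (q div 2)) :: (int ^ 'n) set"
  let ?c = "\<lambda>B. (-1::int) ^ (card B + CARD('n) + dim {x. \<forall>H\<in>B. rvec (a H) \<bullet> x = 0})"
  let ?I = "\<lambda>z. {H \<in> \<A>. int q dvd idot (a H) z - b H}"
  have "int (chi_bar \<A> a b q) = (\<Sum>z\<in>?Z. \<Sum>B\<in>Pow (?I z). ?c B)"
    unfolding chi_bar_eq_sum_sign_patterns(2)[OF A q]
    using A by (simp add: card_sign_patterns)
  also have "\<dots> = (\<Sum>z\<in>?Z. \<Sum>B | B \<in> Pow \<A> \<and> B \<subseteq> ?I z. ?c B)"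
    by (intro sum.cong) auto
  also have "\<dots> = (\<Sum>B\<in>Pow \<A>. \<Sum>z | z \<in> ?Z \<and> B \<subseteq> ?I z. ?c B)"
    using A finite_residue_box by (intro sum.swap_restrict) auto
  also have "\<dots> = (\<Sum>B\<in>Pow \<A>. ?c B * int (card (solutions_mod q (int (q div 2)) a b B)))"
  proof (rule sum.cong)
    fix B assume "B \<in> Pow \<A>"
    then have "{z. z \<in> ?Z \<and> B \<subseteq> ?I z} = solutions_mod q (int (q div 2)) a b B"
      by (auto simp: solutions_mod_def)
    then show "(\<Sum>z | z \<in> ?Z \<and> B \<subseteq> ?I z. ?c B) =
        ?c B * int (card (solutions_mod q (int (q div 2)) a b B))"
      by simp
  qed simp
  finally show ?thesis .
qed

theorem theorem2p5:
  fixes \<A> :: "(real ^ 'n) set set"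
    and a :: "(real ^ 'n) set \<Rightarrow> int ^ 'n"
    and b :: "(real ^ 'n) set \<Rightarrow> int"
  assumes "finite \<A>"
    and "\<And>H. H \<in> \<A> \<Longrightarrow> a H \<noteq> 0"
    and "\<And>H. H \<in> \<A> \<Longrightarrow> H = hyperplane (a H) (real_of_int (b H))"
  shows "\<exists>N. \<forall>q\<ge>N. prime q \<longrightarrow>
    (\<lambda>\<Delta>. card (closure \<Delta> \<inter> lattice_cube q)) summable_on regions_mod \<A> a b q \<and>
    int (chi_bar \<A> a b q) = (-1) ^ CARD('n) * poly (characteristic_poly \<A>) (- int q) \<and>
    \<bar>poly (characteristic_poly \<A>) (- int q)\<bar> = int (chi_bar \<A> a b q)"
proof -
  let ?W = "\<lambda>B. {x. \<forall>H\<in>B. rvec (a H) \<bullet> x = 0}"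
  have Inter: "(\<Inter>H\<in>B. hyperplane (a H) (real_of_int (b H))) = \<Inter>B" if "B \<subseteq> \<A>" for B
  proof -
    have "(\<lambda>H. hyperplane (a H) (real_of_int (b H))) ` B = B"
      using that assms(3) by (force simp: image_iff)
    then show ?thesis by simp
  qed
  have UNIV: "UNIV \<notin> \<A>"
  proof
    assume "UNIV \<in> \<A>"
    \<comment> \<open>At the origin the equation gives \<open>b UNIV = 0\<close>, and at the normal
      itself it then forces the normal to be zero.\<close>
    then have all: "rvec (a UNIV) \<bullet> x = real_of_int (b UNIV)" for x
      using assms(3)[of UNIV] by (auto simp: hyperplane_eq)
    from all[of 0] all[of "rvec (a UNIV)"] have "idot (a UNIV) (a UNIV) = 0"
      by (simp add: rvec_inner_rvec)
    then show False using assms(2)[OF \<open>UNIV \<in> \<A>\<close>] by (simp add: idot_self_eq_0)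
  qed
  have "\<forall>\<^sub>F q in sequentially. \<forall>B\<in>Pow \<A>. prime q \<longrightarrow> (\<forall>h. card (solutions_mod q h a b B) =
    (if (\<Inter>H\<in>B. hyperplane (a H) (real_of_int (b H))) = {} then 0 else q ^ dim (?W B)))"
    using assms(1) by (intro eventually_ball_finite ballI eventually_card_solutions_mod)
      (auto intro: finite_subset)
  \<comment> \<open>The bound \<open>q > 2\<close> makes the prime odd, so that the cube is a full
    box of residues.\<close>
  then have "\<forall>\<^sub>F q in sequentially. q > 2 \<and> (\<forall>B\<in>Pow \<A>. prime q \<longrightarrow>
    (\<forall>h. card (solutions_mod q h a b B) = (if \<Inter>B = {} then 0 else q ^ dim (?W B))))"
    using eventually_gt_at_top[of 2] by eventually_elim (auto simp: Inter)
  then obtain N where N: "\<And>q. q \<ge> N \<Longrightarrow> q > 2 \<and> (\<forall>B\<in>Pow \<A>. prime q \<longrightarrow>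
    (\<forall>h. card (solutions_mod q h a b B) = (if \<Inter>B = {} then 0 else q ^ dim (?W B))))"
    by (auto simp: eventually_sequentially)
  show ?thesis
  proof (intro exI[of _ N] allI impI)
    fix q assume "q \<ge> N" and prime: "prime q"
    then have odd: "odd q" using N prime_odd_nat by blast
    let ?c = "\<lambda>B. (-1::int) ^ (card B + CARD('n) + dim (?W B))"
    have "int (chi_bar \<A> a b q) =
        (\<Sum>B\<in>Pow \<A>. ?c B * int (card (solutions_mod q (int (q div 2)) a b B)))"
      by (rule chi_bar_eq_sum_solutions_mod[OF assms(1) odd])
    also have "\<dots> = (\<Sum>B\<in>Pow \<A>. if \<Inter>B \<noteq> {} then ?c B * int q ^ dim (?W B) else 0)"
      using N[OF \<open>q \<ge> N\<close>] prime by (intro sum.cong) auto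
    also have "\<dots> = (\<Sum>B | B \<in> Pow \<A> \<and> \<Inter>B \<noteq> {}. ?c B * int q ^ dim (?W B))"
      using assms(1) by (intro sum.inter_filter[symmetric]) simp
    \<comment> \<open>The sign \<open>(-1) ^ dim (?W B)\<close> is absorbed into the power of
      \<open>q\<close>, which produces the argument \<open>- int q\<close>.\<close>
    also have "\<dots> = (\<Sum>B | B \<subseteq> \<A> \<and> \<Inter>B \<noteq> {}.
        (-1) ^ CARD('n) * ((-1) ^ card B * (- int q) ^ nat (aff_dim (\<Inter>B))))"
    proof (rule sum.cong)
      fix B assume B: "B \<in> {B. B \<subseteq> \<A> \<and> \<Inter>B \<noteq> {}}"
      then have "nat (aff_dim (\<Inter>B)) = dim (?W B)"
        using aff_dim_Inter_hyperplane[where B = B and a = a and b = "\<lambda>H. real_of_int (b H)"] Inter[of B] by simp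
      then show "?c B * int q ^ dim (?W B) =
          (-1) ^ CARD('n) * ((-1) ^ card B * (- int q) ^ nat (aff_dim (\<Inter>B)))"
        by (simp add: power_minus[of "int q"] power_add mult_ac)
    qed simp
    also have "\<dots> = (-1) ^ CARD('n) * poly (characteristic_poly \<A>) (- int q)"
      unfolding poly_characteristic_poly[OF assms(1) UNIV] by (simp add: sum_distrib_left)
    finally have eq: "int (chi_bar \<A> a b q) = (-1) ^ CARD('n) * poly (characteristic_poly \<A>) (- int q)" .
    have "\<bar>poly (characteristic_poly \<A>) (- int q)\<bar> = \<bar>int (chi_bar \<A> a b q)\<bar>"
      unfolding eq by (simp add: abs_mult power_abs)
    then show "(\<lambda>\<Delta>. card (closure \<Delta> \<inter> lattice_cube q)) summable_on regions_mod \<A> a b q \<and>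
      int (chi_bar \<A> a b q) = (-1) ^ CARD('n) * poly (characteristic_poly \<A>) (- int q) \<and>
      \<bar>poly (characteristic_poly \<A>) (- int q)\<bar> = int (chi_bar \<A> a b q)"
      using eq chi_bar_eq_sum_sign_patterns(1)[OF assms(1) odd] by simp
  qed
qed

end
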